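(* Let $0<T<\infty$, $0<\alpha<1$, and let $\nu\in AC(]0,T])\cap L^1(0,T)$ with $\nu>0$. Assume that there exist $0<\tau_0\le T$, $0<\beta<1-\alpha$ and a function $b\in AC(]0,\tau_0[)$ with $0<b^-\le b(x)\le b^+<\infty$ for all $x$ (for some constants $b^-,b^+$) such that $$x\mapsto x^{1-\beta}\,b(x)\,\nu(x)\quad\text{is decreasing in }(0,\tau_0),$$ and assume that for some $K_0>0$ $$|\nu(x)-\nu(y)|\le \nu(x)-\nu(y)+K_0\,(y-x)\qquad\forall x,y\in(0,T),\ x<y.$$ Then there is a constant $c=c(b(\cdot),\nu(\cdot),T,\alpha,\beta)$, depending only on $b,\nu,T,\alpha,\beta$, such that for every $g\in C^{0,\alpha}([0,T])$ with $g(0)=0$, $$|J_\nu g(x)-J_\nu g(y)|\le c\,[g]_\alpha\,|x-y|^\alpha\,N(|x-y|)\qquad \forall x,y\in(0,T),\ \tfrac y2\le x<y,$$ where $J_\nu g(t)=\int_0^t\nu(t-s)g(s)\,ds$ for $t\in(0,T)$ and $N(x)=\int_0^x\nu(\sigma)\,d\sigma$.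
   Context: Functions are real-valued. $]0,T]$ denotes the half-open interval $(0,T]$, and $]0,\tau_0[$ the open interval. $AC(]0,T])$ (resp. $AC(]0,\tau_0[)$) denotes functions absolutely continuous on every compact subinterval of $]0,T]$ (resp. of $]0,\tau_0[$); they may blow up at $0$. "Decreasing" means non-increasing. $[g]_\alpha=\sup_{x\ne y}|g(x)-g(y)|/|x-y|^\alpha$ is the Hölder seminorm on $[0,T]$. *)

theory Defs
  imports "HOL-Analysis.Analysis"
begin

text \<open>
  Absolute continuity of a function on the compact interval \<open>{a..b}\<close>. The library only has
  absolute continuity of measures. A finite family of subintervals is given by the set of its
  pairs of endpoints; non-overlapping means that the open intervals are disjoint.
\<close>

definition AC_on_interval :: "real \<Rightarrow> real \<Rightarrow> (real \<Rightarrow> real) \<Rightarrow> bool" where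
  "AC_on_interval a b f \<longleftrightarrow>
     (\<forall>\<epsilon>>0. \<exists>\<delta>>0. \<forall>P. finite P \<longrightarrow>
        (\<forall>(u, v)\<in>P. a \<le> u \<and> u \<le> v \<and> v \<le> b) \<longrightarrow>
        pairwise (\<lambda>p q. {fst p<..<snd p} \<inter> {fst q<..<snd q} = {}) P \<longrightarrow>
        (\<Sum>(u, v)\<in>P. v - u) < \<delta> \<longrightarrow>
        (\<Sum>(u, v)\<in>P. \<bar>f v - f u\<bar>) < \<epsilon>)"

definition locally_AC_on :: "real set \<Rightarrow> (real \<Rightarrow> real) \<Rightarrow> bool" where
  "locally_AC_on I f \<longleftrightarrow> (\<forall>a b. a \<le> b \<longrightarrow> {a..b} \<subseteq> I \<longrightarrow> AC_on_interval a b f)"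

definition holder_on :: "real \<Rightarrow> real set \<Rightarrow> (real \<Rightarrow> real) \<Rightarrow> bool" where
  "holder_on \<alpha> S g \<longleftrightarrow> (\<exists>C. \<forall>x\<in>S. \<forall>y\<in>S. \<bar>g x - g y\<bar> \<le> C * \<bar>x - y\<bar> powr \<alpha>)"

text \<open>
  The supremum is a real one: it is meaningful when \<open>S\<close> has at least two points and
  \<open>holder_on \<alpha> S g\<close> holds.
\<close>

definition holder_seminorm :: "real \<Rightarrow> real set \<Rightarrow> (real \<Rightarrow> real) \<Rightarrow> real" where
  "holder_seminorm \<alpha> S g =
     Sup {\<bar>g x - g y\<bar> / \<bar>x - y\<bar> powr \<alpha> | x y. x \<in> S \<and> y \<in> S \<and> x \<noteq> y}"

text \<open>
  The integrals are over the open interval, so that a kernel on \<open>{0<..T}\<close> is never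
  evaluated at \<open>0\<close>.
\<close>

definition conv_op :: "(real \<Rightarrow> real) \<Rightarrow> (real \<Rightarrow> real) \<Rightarrow> real \<Rightarrow> real" where
  "conv_op \<nu> g t = (LBINT s:{0<..<t}. \<nu> (t - s) * g s)"

definition kernel_primitive :: "(real \<Rightarrow> real) \<Rightarrow> real \<Rightarrow> real" where
  "kernel_primitive \<nu> x = (LBINT \<sigma>:{0<..<x}. \<nu> \<sigma>)"

end

theory Submission
  imports Defs
begin

text \<open>
  The idea is to reduce everything to one property of the kernel: up to a factor \<open>C\<close>, the function
  \<open>s powr (1 - \<beta>) * \<nu> s\<close> is decreasing on the whole of \<open>{0<..T}\<close>. Near \<open>0\<close> this is the monotonicity
  hypothesis with the bounded factor \<open>b\<close> absorbed into the constant; away from \<open>0\<close> the kernel lies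
  between two positive constants, by continuity and compactness
  (\<open>almost_decreasing_of_antimono_near_0\<close>). Averaging over \<open>{0<..<h}\<close> gives the central pointwise bound
  \<open>kernel_le_primitive\<close>: for \<open>h \<le> s\<close>, \<open>\<nu> s\<close> is at most a constant times
  \<open>N h * h powr (-\<beta>) * s powr (\<beta> - 1)\<close>. It turns each integral of \<open>\<nu>\<close> over values beyond \<open>h\<close> into
  an integral of a power, and since \<open>\<alpha> + \<beta> < 1\<close> those are dominated by their value at the scale \<open>h\<close>.

  Put \<open>h = y - x\<close>, so that \<open>h \<le> x\<close> because \<open>y / 2 \<le> x\<close>. Subtracting the constant \<open>g x\<close> from \<open>g\<close>
  under both integrals splits the increment of \<open>conv_op \<nu> g\<close> into three parts
  (\<open>conv_op_difference\<close>). Only the values of \<open>\<nu>\<close> on \<open>{0<..<h}\<close> enter the second one, which is at most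
  \<open>[g] * h powr \<alpha> * N h\<close>. The third is \<open>g x\<close> times the mass of \<open>\<nu>\<close> on \<open>{x<..<y}\<close>; here \<open>g 0 = 0\<close>
  gives \<open>\<bar>g x\<bar> \<le> [g] * x powr \<alpha>\<close>, and the growth of \<open>x powr \<alpha>\<close> is outweighed by the decay of the
  kernel (\<open>primitive_increment_bound\<close>).

  In the first part the weight \<open>s powr \<alpha>\<close> is integrated against \<open>\<bar>\<nu> s - \<nu> (s + h)\<bar>\<close>. The hypothesis
  on \<open>K\<^sub>0\<close> says that \<open>\<nu>\<close> is decreasing up to a Lipschitz error, so the absolute value can be replaced by
  the difference itself plus \<open>K\<^sub>0 * h\<close>. In the difference the shift by \<open>h\<close> is moved onto the weight, a
  summation by parts, whose increments are at most \<open>h * s powr (\<alpha> - 1)\<close>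
  (\<open>kernel_variation_bound\<close>). The error is linear in \<open>h\<close>, and \<open>h\<close> is at most a constant times
  \<open>h powr \<alpha> * N h\<close>, because \<open>N h\<close> is at least of order \<open>h powr \<beta>\<close> (\<open>linear_le_primitive\<close>).
\<close>

section \<open>Absolutely continuous and Hoelder functions\<close>

lemma locally_AC_on_imp_continuous_on:
  assumes "locally_AC_on I f" "{a..b} \<subseteq> I"
  shows "continuous_on {a..b} f"
proof (cases "a \<le> b")
  case True
  with assms have ac: "AC_on_interval a b f" by (simp add: locally_AC_on_def)
  show ?thesis
    unfolding continuous_on_iff
  proof (intro ballI allI impI)
    fix x e :: real
    assume x: "x \<in> {a..b}" and "0 < e"
    then obtain d where "d > 0" and d: "\<And>P. finite P \<Longrightarrow> (\<forall>(u, v)\<in>P. a \<le> u \<and> u \<le> v \<and> v \<le> b) \<Longrightarrow>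
        pairwise (\<lambda>p q. {fst p<..<snd p} \<inter> {fst q<..<snd q} = {}) P \<Longrightarrow>
        (\<Sum>(u, v)\<in>P. v - u) < d \<Longrightarrow> (\<Sum>(u, v)\<in>P. \<bar>f v - f u\<bar>) < e"
      using ac unfolding AC_on_interval_def by meson
    have "dist (f y) (f x) < e" if y: "y \<in> {a..b}" "dist y x < d" for y
    proof -
      have "(\<Sum>(u, v)\<in>{(min x y, max x y)}. \<bar>f v - f u\<bar>) < e"
        using x y by (intro d) (auto simp: dist_real_def)
      then show ?thesis
        by (cases "x \<le> y") (auto simp: dist_real_def min_def max_def)
    qed
    with \<open>d > 0\<close> show "\<exists>d>0. \<forall>y\<in>{a..b}. dist y x < d \<longrightarrow> dist (f y) (f x) < e" by blast
  qed
qed simp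

text \<open>
  The supremum that defines the seminorm is a real one, so it bounds the quotients only because
  \<open>holder_on\<close> makes them bounded above.
\<close>

lemma holder_seminorm_bound:
  assumes "holder_on \<alpha> S g" "x \<in> S" "y \<in> S"
  shows "\<bar>g x - g y\<bar> \<le> holder_seminorm \<alpha> S g * \<bar>x - y\<bar> powr \<alpha>"
proof (cases "x = y")
  case False
  obtain C where C: "\<And>x y. x \<in> S \<Longrightarrow> y \<in> S \<Longrightarrow> \<bar>g x - g y\<bar> \<le> C * \<bar>x - y\<bar> powr \<alpha>"
    using assms(1) unfolding holder_on_def by blast
  let ?Q = "{\<bar>g x - g y\<bar> / \<bar>x - y\<bar> powr \<alpha> | x y. x \<in> S \<and> y \<in> S \<and> x \<noteq> y}"
  have "bdd_above ?Q"
    using C by (intro bdd_aboveI[of _ C]) (auto simp: divide_le_eq)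
  then have "\<bar>g x - g y\<bar> / \<bar>x - y\<bar> powr \<alpha> \<le> Sup ?Q"
    using assms False by (intro cSup_upper) auto
  then show ?thesis
    using False by (simp add: holder_seminorm_def divide_le_eq)
qed simp

lemma holder_seminorm_nonneg:
  assumes "holder_on \<alpha> S g" "x \<in> S" "y \<in> S" "x \<noteq> y"
  shows "0 \<le> holder_seminorm \<alpha> S g"
proof -
  have "0 \<le> holder_seminorm \<alpha> S g * \<bar>x - y\<bar> powr \<alpha>"
    using holder_seminorm_bound[OF assms(1-3)] by linarith
  then show ?thesis using assms(4) by (simp add: zero_le_mult_iff)
qed

lemma holder_on_imp_continuous_on:
  assumes "holder_on \<alpha> S g" "0 < \<alpha>"
  shows "continuous_on S g"
  unfolding continuous_on_def
proof
  fix x assume x: "x \<in> S"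
  let ?L = "holder_seminorm \<alpha> S g"
  have "((\<lambda>y. ?L * \<bar>y - x\<bar> powr \<alpha>) \<longlongrightarrow> ?L * \<bar>x - x\<bar> powr \<alpha>) (at x within S)"
    using assms(2) by (intro tendsto_intros) auto
  then have "((\<lambda>y. ?L * \<bar>y - x\<bar> powr \<alpha>) \<longlongrightarrow> 0) (at x within S)"
    using assms(2) by simp
  moreover have "\<forall>\<^sub>F y in at x within S. norm (g y - g x) \<le> ?L * \<bar>y - x\<bar> powr \<alpha>"
    using holder_seminorm_bound[OF assms(1) _ x] by (auto simp: eventually_at_filter)
  ultimately have "((\<lambda>y. g y - g x) \<longlongrightarrow> 0) (at x within S)"
    by (rule Lim_null_comparison[rotated])
  then show "(g \<longlongrightarrow> g x) (at x within S)" by (simp add: LIM_zero_iff)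
qed

section \<open>Kernels that decrease up to a constant factor\<close>

text \<open>
  The factor \<open>b\<close> costs \<open>bp / bm\<close> on the left half of the interval where monotonicity is known. On the
  remaining compact interval \<open>w\<close> has a positive minimum and a finite maximum, whose quotient is the
  cost there. When \<open>r\<close> and \<open>s\<close> lie on different sides, going through the dividing point \<open>\<tau>\<close> multiplies
  the two costs.
\<close>

lemma almost_decreasing_of_antimono_near_0:
  fixes w b :: "real \<Rightarrow> real"
  assumes "0 < \<tau>\<^sub>0" "\<tau>\<^sub>0 \<le> T"
    and cont: "\<And>a. 0 < a \<Longrightarrow> continuous_on {a..T} w"
    and pos: "\<And>x. 0 < x \<Longrightarrow> x \<le> T \<Longrightarrow> 0 < w x"
    and "0 < bm" and b: "\<And>x. x \<in> {0<..<\<tau>\<^sub>0} \<Longrightarrow> bm \<le> b x \<and> b x \<le> bp"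
    and anti: "antimono_on {0<..<\<tau>\<^sub>0} (\<lambda>x. b x * w x)"
  shows "\<exists>C>0. \<forall>r s. 0 < r \<longrightarrow> r \<le> s \<longrightarrow> s \<le> T \<longrightarrow> w s \<le> C * w r"
proof -
  \<comment> \<open>Any point of the open interval would do; at \<open>\<tau>\<^sub>0\<close> itself nothing is known about \<open>b\<close>.\<close>
  define \<tau> where "\<tau> = \<tau>\<^sub>0 / 2"
  have \<tau>: "0 < \<tau>" "\<tau> < \<tau>\<^sub>0" "\<tau> \<le> T" using assms by (auto simp: \<tau>_def)
  have ne: "compact {\<tau>..T}" "{\<tau>..T} \<noteq> {}" using \<tau> by auto
  obtain u where u: "u \<in> {\<tau>..T}" "\<And>x. x \<in> {\<tau>..T} \<Longrightarrow> w u \<le> w x"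
    using continuous_attains_inf[OF ne cont[OF \<tau>(1)]] by blast
  obtain v where v: "v \<in> {\<tau>..T}" "\<And>x. x \<in> {\<tau>..T} \<Longrightarrow> w x \<le> w v"
    using continuous_attains_sup[OF ne cont[OF \<tau>(1)]] by blast
  have wu: "0 < w u" using pos u \<tau> by auto
  define A where "A = w v / w u"
  define B where "B = bp / bm"
  have A1: "A \<ge> 1" using u(2)[OF v(1)] wu by (simp add: A_def)
  have B1: "B \<ge> 1" using b[of \<tau>] \<tau> \<open>0 < bm\<close> by (simp add: B_def)
  have large: "w s \<le> A * w r" if "\<tau> \<le> r" "r \<le> T" "\<tau> \<le> s" "s \<le> T" for r s
  proof -
    have "w s \<le> A * w u" using v(2)[of s] that wu by (simp add: A_def)
    also have "\<dots> \<le> A * w r" using u(2)[of r] that A1 by (intro mult_left_mono) auto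
    finally show ?thesis .
  qed
  have small: "w s \<le> B * w r" if "0 < r" "r \<le> s" "s \<le> \<tau>" for r s
  proof -
    have ws: "0 < w s" "0 < w r" using pos that \<tau> by auto
    have "bm * w s \<le> b s * w s" using b[of s] that \<tau> ws by (intro mult_right_mono) auto
    also have "\<dots> \<le> b r * w r" using monotone_onD[OF anti, of r s] that \<tau> by auto
    also have "\<dots> \<le> bp * w r" using b[of r] that \<tau> ws by (intro mult_right_mono) auto
    finally show ?thesis using \<open>0 < bm\<close> by (simp add: B_def field_simps)
  qed
  have "w s \<le> (A * B) * w r" if rs: "0 < r" "r \<le> s" "s \<le> T" for r s
  proof -
    have wr: "0 < w r" using pos rs by auto
    consider "s \<le> \<tau>" | "r \<le> \<tau>" "\<tau> \<le> s" | "\<tau> \<le> r" by linarith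
    then show ?thesis
    proof cases
      case 1
      have "w s \<le> 1 * (B * w r)" using small[OF rs(1,2) 1] by simp
      also have "\<dots> \<le> A * (B * w r)" using A1 B1 wr by (intro mult_right_mono) auto
      finally show ?thesis by (simp add: mult.assoc)
    next
      case 2
      have "w s \<le> A * w \<tau>" using large[of \<tau> s] rs 2 \<tau> by auto
      also have "\<dots> \<le> A * (B * w r)" using small[of r \<tau>] 2 rs A1 by (intro mult_left_mono) auto
      finally show ?thesis by (simp add: mult.assoc)
    next
      case 3
      have "w s \<le> A * (1 * w r)" using large[of r s] rs 3 by simp
      also have "\<dots> \<le> A * (B * w r)" using A1 B1 wr by (intro mult_left_mono mult_right_mono) auto
      finally show ?thesis by (simp add: mult.assoc)
    qed
  qed
  moreover have "0 < A * B" using A1 B1 by auto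
  ultimately show ?thesis by blast
qed

section \<open>Lebesgue integrals over intervals\<close>

lemma set_integrable_mult_continuous:
  fixes \<nu> \<phi> :: "real \<Rightarrow> real"
  assumes \<nu>: "set_integrable lborel S \<nu>" and S: "S \<in> sets borel" "S \<subseteq> {a..b}"
    and \<phi>: "continuous_on {a..b} \<phi>"
  shows "set_integrable lborel S (\<lambda>s. \<nu> s * \<phi> s)"
proof -
  have "bounded (\<phi> ` {a..b})" using compact_continuous_image[OF \<phi>] compact_imp_bounded by blast
  then obtain B where B: "\<And>s. s \<in> {a..b} \<Longrightarrow> norm (\<phi> s) \<le> B"
    unfolding bounded_iff by (metis imageI)
  show ?thesis
  proof (rule set_integrable_bound)
    show "set_integrable lborel S (\<lambda>s. B * \<nu> s)" using \<nu> by auto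
    have "(\<lambda>s. indicator S s *\<^sub>R \<nu> s) \<in> borel_measurable borel"
      using \<nu>[unfolded set_integrable_def, THEN borel_measurable_integrable] by simp
    moreover have "(\<lambda>s. indicator S s *\<^sub>R \<phi> s) \<in> borel_measurable borel"
      using \<phi> S by (intro borel_measurable_continuous_on_indicator) (auto intro: continuous_on_subset)
    ultimately have "(\<lambda>s. (indicator S s *\<^sub>R \<nu> s) * (indicator S s *\<^sub>R \<phi> s)) \<in> borel_measurable borel"
      by (rule borel_measurable_times)
    also have "(\<lambda>s. (indicator S s *\<^sub>R \<nu> s) * (indicator S s *\<^sub>R \<phi> s)) = (\<lambda>s. indicator S s *\<^sub>R (\<nu> s * \<phi> s))"
      by (auto simp: indicator_def)
    finally show "set_borel_measurable lborel S (\<lambda>s. \<nu> s * \<phi> s)"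
      by (simp add: set_borel_measurable_def)
    show "AE s\<in>S in lborel. norm (\<nu> s * \<phi> s) \<le> norm (B * \<nu> s)"
    proof (intro AE_I2 impI)
      fix s assume "s \<in> S"
      then have "\<bar>\<phi> s\<bar> \<le> \<bar>B\<bar>" using B[of s] S by auto
      then show "norm (\<nu> s * \<phi> s) \<le> norm (B * \<nu> s)"
        by (simp add: abs_mult mult.commute[of "\<bar>B\<bar>"] mult_left_mono)
    qed
  qed
qed

lemma set_integral_reflect_interval:
  fixes F :: "real \<Rightarrow> real"
  shows "(LBINT s:{0<..<t}. F (t - s)) = (LBINT s:{0<..<t}. F s)"
proof -
  have "(LBINT s:{0<..<t}. F s) = (LBINT s. indicator {0<..<t} (t + (-1) * s) *\<^sub>R F (t + (-1) * s))"
    unfolding set_lebesgue_integral_def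
    by (subst lborel_integral_real_affine[of "-1" _ t]) auto
  also have "\<dots> = (LBINT s:{0<..<t}. F (t - s))"
    unfolding set_lebesgue_integral_def by (intro Bochner_Integration.integral_cong) (auto simp: indicator_def)
  finally show ?thesis ..
qed

text \<open>
  The right-hand side is kept as an unreduced application, so that it has the form in which the affine
  change of variables for \<open>lborel\<close> is stated.
\<close>

lemma indicator_shift_interval:
  fixes F :: "real \<Rightarrow> real"
  shows "(\<lambda>s. indicator {a<..<b} s *\<^sub>R F (s + h))
    = (\<lambda>s. (\<lambda>s. indicator {a+h<..<b+h} s *\<^sub>R F s) (h + 1 * s))"
  by (auto simp: indicator_def add.commute)

lemma set_integral_shift_interval:
  fixes F :: "real \<Rightarrow> real"
  shows "(LBINT s:{a<..<b}. F (s + h)) = (LBINT s:{a+h<..<b+h}. F s)"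
  using lborel_integral_real_affine[of 1 "\<lambda>s. indicator {a+h<..<b+h} s *\<^sub>R F s" h]
    indicator_shift_interval[of a b F h]
  by (simp add: set_lebesgue_integral_def)

lemma set_integrable_shift_interval:
  fixes F :: "real \<Rightarrow> real"
  shows "set_integrable lborel {a<..<b} (\<lambda>s. F (s + h)) \<longleftrightarrow> set_integrable lborel {a+h<..<b+h} F"
  using lborel_integrable_real_affine_iff[of 1 "\<lambda>s. indicator {a+h<..<b+h} s *\<^sub>R F s" h]
    indicator_shift_interval[of a b F h]
  by (simp add: set_integrable_def)

text \<open>
  All intervals are open, since kernels are only controlled away from \<open>0\<close>; the dividing point is a
  null set.
\<close>

lemma set_integral_split_interval:
  fixes F :: "real \<Rightarrow> real"
  assumes F: "set_integrable lborel {a<..<c} F" and "a \<le> b" "b \<le> c"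
  shows "(LBINT s:{a<..<c}. F s) = (LBINT s:{a<..<b}. F s) + (LBINT s:{b<..<c}. F s)"
proof -
  have i: "set_integrable lborel {a<..<b} F" "set_integrable lborel {b<..<c} F"
    using assms by (auto intro: set_integrable_subset[OF F])
  have "(LBINT s:{a<..<b} \<union> {b<..<c}. F s) = (LBINT s:{a<..<b}. F s) + (LBINT s:{b<..<c}. F s)"
    using i by (intro set_integral_Un) auto
  moreover have "(LBINT s:{a<..<b} \<union> {b<..<c}. F s) = (LBINT s:{a<..<c}. F s)"
    unfolding set_lebesgue_integral_def
  proof (rule integral_cong_AE)
    show "(\<lambda>x. indicat_real ({a<..<b} \<union> {b<..<c}) x *\<^sub>R F x) \<in> borel_measurable lborel"
      using set_integrable_Un[OF i] unfolding set_integrable_def by auto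
    show "(\<lambda>x. indicat_real {a<..<c} x *\<^sub>R F x) \<in> borel_measurable lborel"
      using F unfolding set_integrable_def by auto
    show "AE x in lborel. indicat_real ({a<..<b} \<union> {b<..<c}) x *\<^sub>R F x = indicat_real {a<..<c} x *\<^sub>R F x"
      using AE_lborel_singleton[of b] by eventually_elim (use assms(2,3) in \<open>auto simp: indicator_def\<close>)
  qed
  ultimately show ?thesis by simp
qed

lemma set_integral_abs_bound:
  fixes f g :: "real \<Rightarrow> real"
  assumes f: "set_integrable M S f" and g: "set_integrable M S g"
    and le: "\<And>x. x \<in> S \<Longrightarrow> \<bar>f x\<bar> \<le> g x"
  shows "\<bar>set_lebesgue_integral M S f\<bar> \<le> set_lebesgue_integral M S g"
proof -
  have "set_lebesgue_integral M S f \<le> set_lebesgue_integral M S g"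
    using le by (intro set_integral_mono f g) force
  moreover have "- set_lebesgue_integral M S g \<le> set_lebesgue_integral M S f"
  proof -
    have "set_lebesgue_integral M S (\<lambda>x. - g x) \<le> set_lebesgue_integral M S f"
    proof (rule set_integral_mono)
      show "set_integrable M S (\<lambda>x. - g x)" using set_integrable_mult_right[of "-1" M S g] g by simp
    qed (use f le in \<open>force+\<close>)
    then show ?thesis using set_integral_uminus[OF g] by simp
  qed
  ultimately show ?thesis by linarith
qed

lemma set_integral_powr:
  fixes h x p :: real
  assumes "0 < h" "h \<le> x" "p \<noteq> -1"
  shows "set_integrable lborel {h<..<x} (\<lambda>s. s powr p)"
    and "(LBINT s:{h<..<x}. s powr p) = (x powr (p + 1) - h powr (p + 1)) / (p + 1)"
proof -
  have c: "continuous_on {h..x} (\<lambda>s. s powr p)"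
    by (intro continuous_on_powr' continuous_on_id continuous_on_const) (use assms in auto)
  then show i: "set_integrable lborel {h<..<x} (\<lambda>s. s powr p)"
    by (intro set_integrable_subset[OF borel_integrable_atLeastAtMost'[OF c]]) auto
  have "(LBINT s:{h<..<x}. s powr p) = (LBINT s:{h..x}. s powr p)"
    unfolding set_lebesgue_integral_def
  proof (rule integral_cong_AE)
    show "AE s in lborel. indicat_real {h<..<x} s *\<^sub>R s powr p = indicat_real {h..x} s *\<^sub>R s powr p"
      using AE_lborel_singleton[of h] AE_lborel_singleton[of x]
      by eventually_elim (auto simp: indicator_def)
  qed auto
  also have "\<dots> = x powr (p + 1) / (p + 1) - h powr (p + 1) / (p + 1)"
    unfolding set_lebesgue_integral_def
  proof (rule integral_FTC_Icc)
    fix s assume "h \<le> s" "s \<le> x"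
    then have "((\<lambda>s. s powr (p + 1) / (p + 1)) has_real_derivative
        (p + 1) * s powr (p + 1 - 1) / (p + 1)) (at s)"
      using assms(1) by (intro DERIV_cdivide has_real_derivative_powr) auto
    then have "((\<lambda>s. s powr (p + 1) / (p + 1)) has_real_derivative s powr p) (at s)"
      using assms(3) by simp
    then show "((\<lambda>s. s powr (p + 1) / (p + 1)) has_vector_derivative s powr p) (at s within {h..x})"
      by (simp add: has_real_derivative_iff_has_vector_derivative has_vector_derivative_at_within)
  qed (use assms c in auto)
  finally show "(LBINT s:{h<..<x}. s powr p) = (x powr (p + 1) - h powr (p + 1)) / (p + 1)"
    by (simp add: diff_divide_distrib)
qed

text \<open>
  After division by \<open>s powr \<alpha>\<close> this is \<open>1 - q powr \<alpha> \<le> 1 - q\<close> for \<open>q = (s - h) / s\<close>, which holds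
  because \<open>0 \<le> q \<le> 1\<close> and \<open>\<alpha> \<le> 1\<close>.
\<close>

lemma powr_increment_le:
  fixes \<alpha> h s :: real
  assumes "0 < \<alpha>" "\<alpha> \<le> 1" "0 < h" "h \<le> s"
  shows "s powr \<alpha> - (s - h) powr \<alpha> \<le> h * s powr (\<alpha> - 1)"
proof -
  have s: "0 < s" using assms by simp
  have "(s - h) / s \<le> ((s - h) / s) powr \<alpha>"
    using assms powr_mono'[of \<alpha> 1 "(s - h) / s"] by (simp add: powr_one)
  then have "s powr \<alpha> * ((s - h) / s) \<le> s powr \<alpha> * ((s - h) powr \<alpha> / s powr \<alpha>)"
    using assms by (intro mult_left_mono) (auto simp: powr_divide)
  then show ?thesis
    using s by (simp add: powr_diff field_simps)
qed

section \<open>The increment of a convolution\<close>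

lemma conv_op_reflect: "conv_op \<nu> g t = (LBINT s:{0<..<t}. \<nu> s * g (t - s))"
  unfolding conv_op_def
  using set_integral_reflect_interval[of t "\<lambda>s. \<nu> s * g (t - s)"] by simp

text \<open>
  After reflection both integrals have their singularity at \<open>s = 0\<close>. In the one for \<open>y\<close> the range
  splits at \<open>h\<close>, and the part beyond \<open>h\<close> is shifted so that \<open>g\<close> is evaluated at the same points as in the
  integral for \<open>x\<close>. Subtracting \<open>g x\<close> from \<open>g\<close> leaves \<open>g x\<close> times the difference of the
  total masses, which is the integral over \<open>{x<..<y}\<close>.
\<close>

lemma conv_op_difference:
  assumes \<nu>: "set_integrable lborel {0<..<y} \<nu>" and g: "continuous_on {0..y} g"
    and xy: "0 \<le> x" "x \<le> y" and h: "h = y - x"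
  shows "conv_op \<nu> g y - conv_op \<nu> g x =
      (LBINT s:{0<..<x}. (\<nu> (s + h) - \<nu> s) * (g (x - s) - g x))
    + (LBINT s:{0<..<h}. \<nu> s * (g (y - s) - g x))
    + g x * (LBINT s:{x<..<y}. \<nu> s)"
proof -
  have hb: "0 \<le> h" "h \<le> y" "y = x + h" using xy h by auto
  have sub: "set_integrable lborel {u<..<v} \<nu>" if "0 \<le> u" "v \<le> y" for u v
    using that by (intro set_integrable_subset[OF \<nu>]) auto
  have gy: "continuous_on {0..y} (\<lambda>s. g (y - s))"
    by (intro continuous_on_compose2[OF g] continuous_intros) auto
  have gx: "continuous_on {0..x} (\<lambda>s. g (x - s))"
    using xy by (intro continuous_on_compose2[OF g] continuous_intros) auto
  have \<nu>h: "set_integrable lborel {0<..<x} (\<lambda>s. \<nu> (s + h))"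
    using sub[of h y] hb by (simp add: set_integrable_shift_interval)
  have i1: "set_integrable lborel {0<..<x} (\<lambda>s. \<nu> s * g (x - s))"
    using sub[of 0 x] xy gx by (intro set_integrable_mult_continuous) auto
  have i2: "set_integrable lborel {0<..<x} (\<lambda>s. \<nu> (s + h) * g (x - s))"
    using \<nu>h gx by (intro set_integrable_mult_continuous) auto
  have iy: "set_integrable lborel {0<..<y} (\<lambda>s. \<nu> s * g (y - s))"
    using \<nu> gy by (intro set_integrable_mult_continuous) auto
  have i3: "set_integrable lborel {0<..<h} (\<lambda>s. \<nu> s * g (y - s))"
    using hb by (intro set_integrable_subset[OF iy]) auto
  have cy: "conv_op \<nu> g y = (LBINT s:{0<..<h}. \<nu> s * g (y - s)) + (LBINT s:{h<..<y}. \<nu> s * g (y - s))"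
    unfolding conv_op_reflect using hb by (intro set_integral_split_interval iy)
  have sh: "(LBINT s:{h<..<y}. \<nu> s * g (y - s)) = (LBINT s:{0<..<x}. \<nu> (s + h) * g (x - s))"
    using set_integral_shift_interval[of 0 x "\<lambda>s. \<nu> s * g (y - s)" h] hb by simp
  have "(LBINT s:{h<..<y}. \<nu> s) = (LBINT s:{0<..<x}. \<nu> (s + h))"
    using set_integral_shift_interval[of 0 x \<nu> h] hb by simp
  moreover have "(LBINT s:{0<..<y}. \<nu> s) = (LBINT s:{0<..<h}. \<nu> s) + (LBINT s:{h<..<y}. \<nu> s)"
    "(LBINT s:{0<..<y}. \<nu> s) = (LBINT s:{0<..<x}. \<nu> s) + (LBINT s:{x<..<y}. \<nu> s)"
    by (rule set_integral_split_interval[OF \<nu>]; use hb xy in simp)+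
  ultimately have n: "(LBINT s:{x<..<y}. \<nu> s) = (LBINT s:{0<..<h}. \<nu> s)
      + (LBINT s:{0<..<x}. \<nu> (s + h)) - (LBINT s:{0<..<x}. \<nu> s)"
    by simp
  have d1: "(LBINT s:{0<..<x}. (\<nu> (s + h) - \<nu> s) * (g (x - s) - g x)) =
      ((LBINT s:{0<..<x}. \<nu> (s + h) * g (x - s)) - (LBINT s:{0<..<x}. \<nu> s * g (x - s)))
      - ((LBINT s:{0<..<x}. \<nu> (s + h)) - (LBINT s:{0<..<x}. \<nu> s)) * g x"
  proof -
    have "(LBINT s:{0<..<x}. (\<nu> (s + h) - \<nu> s) * (g (x - s) - g x)) =
      (LBINT s:{0<..<x}. (\<nu> (s + h) * g (x - s) - \<nu> s * g (x - s)) - (\<nu> (s + h) - \<nu> s) * g x)"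
      by (simp add: algebra_simps)
    then show ?thesis
      using i1 i2 \<nu>h sub[of 0 x] xy by (simp add: set_integral_diff)
  qed
  have d2: "(LBINT s:{0<..<h}. \<nu> s * (g (y - s) - g x)) =
      (LBINT s:{0<..<h}. \<nu> s * g (y - s)) - (LBINT s:{0<..<h}. \<nu> s) * g x"
    using i3 sub[of 0 h] hb by (simp add: right_diff_distrib set_integral_diff)
  have "g x * (LBINT s:{x<..<y}. \<nu> s) = (LBINT s:{0<..<h}. \<nu> s) * g x
      + ((LBINT s:{0<..<x}. \<nu> (s + h)) - (LBINT s:{0<..<x}. \<nu> s)) * g x"
    by (simp only: n mult.commute[of "g x"] distrib_right left_diff_distrib add_diff_eq)
  then show ?thesis
    using conv_op_reflect[of \<nu> g x] cy sh d1 d2 by linarith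
qed

section \<open>Estimates for almost decreasing kernels\<close>

text \<open>
  The exponent \<open>1 - \<beta>\<close> makes \<open>s powr (\<beta> - 1)\<close> the model kernel, whose primitive is of order
  \<open>h powr \<beta>\<close>. The factor \<open>C\<close> records how far \<open>\<nu>\<close> is from being the model kernel times a decreasing
  function.
\<close>

locale almost_decreasing_kernel =
  fixes \<nu> :: "real \<Rightarrow> real" and T \<beta> C :: real
  assumes T_pos: "0 < T"
    and integrable: "set_integrable lborel {0<..<T} \<nu>"
    and pos: "\<And>s. 0 < s \<Longrightarrow> s \<le> T \<Longrightarrow> 0 < \<nu> s"
    and beta: "0 < \<beta>" "\<beta> < 1"
    and C_pos: "0 < C"
    and almost_decreasing: "\<And>r s. 0 < r \<Longrightarrow> r \<le> s \<Longrightarrow> s \<le> T \<Longrightarrow>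
      s powr (1 - \<beta>) * \<nu> s \<le> C * (r powr (1 - \<beta>) * \<nu> r)"
begin

abbreviation N where "N \<equiv> kernel_primitive \<nu>"

lemma integrable_sub: "0 \<le> u \<Longrightarrow> v \<le> T \<Longrightarrow> set_integrable lborel {u<..<v} \<nu>"
  by (rule set_integrable_subset[OF integrable]) auto

text \<open>
  Almost monotonicity bounds \<open>\<nu>\<close> from below on \<open>{0<..<h}\<close> by the constant \<open>k\<close>, so \<open>N h\<close> is at least
  \<open>k * h\<close>. Replacing \<open>r powr (1 - \<beta>)\<close> by its largest value \<open>h powr (1 - \<beta>)\<close> loses only a constant
  and avoids integrating a singular power.
\<close>

lemma kernel_le_primitive:
  assumes "0 < h" "h \<le> s" "s \<le> T"
  shows "\<nu> s \<le> C * N h * h powr (-\<beta>) * s powr (\<beta> - 1)"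
proof -
  define k where "k = s powr (1 - \<beta>) * \<nu> s / (C * h powr (1 - \<beta>))"
  have k: "k \<le> \<nu> r" if "r \<in> {0<..<h}" for r
  proof -
    have "0 < \<nu> r" using pos that assms by auto
    have "s powr (1 - \<beta>) * \<nu> s \<le> C * (r powr (1 - \<beta>) * \<nu> r)"
      using that assms by (intro almost_decreasing) auto
    also have "\<dots> \<le> C * (h powr (1 - \<beta>) * \<nu> r)"
      using that beta C_pos \<open>0 < \<nu> r\<close> by (intro mult_left_mono mult_right_mono powr_mono2) auto
    finally show ?thesis using C_pos assms by (simp add: k_def field_simps)
  qed
  have "(LBINT r:{0<..<h}. k) \<le> (LBINT r:{0<..<h}. \<nu> r)"
    using assms k by (intro set_integral_mono integrable_sub) (auto simp: set_integrable_def)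
  then have "k * h \<le> N h"
    using assms by (simp add: kernel_primitive_def set_lebesgue_integral_def mult.commute)
  then have "s powr (1 - \<beta>) * \<nu> s \<le> C * N h * (h powr (1 - \<beta>) / h)"
    using assms C_pos by (simp add: k_def field_simps)
  also have "h powr (1 - \<beta>) / h = h powr (-\<beta>)"
    using assms by (simp add: powr_diff powr_minus field_simps)
  finally have "s powr (\<beta> - 1) * (s powr (1 - \<beta>) * \<nu> s) \<le> s powr (\<beta> - 1) * (C * N h * h powr (-\<beta>))"
    by (intro mult_left_mono) auto
  moreover have "s powr (\<beta> - 1) * (s powr (1 - \<beta>) * \<nu> s) = \<nu> s"
    using assms by (simp add: powr_add[symmetric] flip: mult.assoc)
  moreover have "s powr (\<beta> - 1) * (C * N h * h powr (-\<beta>)) = C * N h * h powr (-\<beta>) * s powr (\<beta> - 1)"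
    by (simp only: mult_ac)
  ultimately show ?thesis by linarith
qed

lemma primitive_nonneg: "h \<le> T \<Longrightarrow> 0 \<le> N h"
  unfolding kernel_primitive_def set_lebesgue_integral_def
  using pos by (intro Bochner_Integration.integral_nonneg) (auto simp: indicator_def intro: less_imp_le)

text \<open>
  The bound of \<open>kernel_le_primitive\<close> at the endpoint \<open>s = T\<close> says that \<open>N h\<close> is at least of order
  \<open>h powr \<beta>\<close>. Hence errors that are linear in \<open>h\<close> are harmless as long as \<open>\<alpha> + \<beta> \<le> 1\<close>.
\<close>

lemma linear_le_primitive:
  assumes "0 < h" "h \<le> T" "\<alpha> + \<beta> \<le> 1"
  shows "h * (T powr \<alpha> * \<nu> T) \<le> C * (h powr \<alpha> * N h)"
proof -
  have "T powr \<alpha> * \<nu> T \<le> T powr \<alpha> * (C * N h * h powr (-\<beta>) * T powr (\<beta> - 1))"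
    using assms by (intro mult_left_mono kernel_le_primitive) auto
  also have "\<dots> = C * N h * h powr (-\<beta>) * T powr (\<alpha> + \<beta> - 1)"
    using T_pos by (simp add: powr_add[symmetric] mult_ac) (simp add: algebra_simps)
  also have "\<dots> \<le> C * N h * h powr (-\<beta>) * h powr (\<alpha> + \<beta> - 1)"
    using assms C_pos primitive_nonneg[of h] by (intro mult_left_mono powr_mono2') auto
  also have "\<dots> = C * N h * (h powr \<alpha> / h)"
    using assms by (simp add: powr_add powr_diff powr_minus field_simps)
  finally show ?thesis using assms by (simp add: field_simps)
qed

text \<open>
  On \<open>{x<..<x+h}\<close> the kernel is at most a constant times \<open>N h * h powr (-\<beta>) * x powr (\<beta> - 1)\<close>. The
  resulting power \<open>x powr (\<alpha> + \<beta> - 1)\<close> has a nonpositive exponent, so it is largest at \<open>x = h\<close>.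
\<close>

lemma primitive_increment_bound:
  assumes "0 < h" "h \<le> x" "x + h \<le> T" "\<alpha> + \<beta> \<le> 1"
  shows "x powr \<alpha> * (LBINT s:{x<..<x+h}. \<nu> s) \<le> C * (h powr \<alpha> * N h)"
proof -
  let ?k = "C * N h * h powr (-\<beta>)"
  have k: "0 \<le> ?k" using C_pos primitive_nonneg[of h] assms by auto
  have "(LBINT s:{x<..<x+h}. \<nu> s) \<le> (LBINT s:{x<..<x+h}. ?k * x powr (\<beta> - 1))"
  proof (intro set_integral_mono integrable_sub)
    fix s assume s: "s \<in> {x<..<x+h}"
    then have "\<nu> s \<le> ?k * s powr (\<beta> - 1)" using assms by (intro kernel_le_primitive) auto
    also have "\<dots> \<le> ?k * x powr (\<beta> - 1)"
      using s assms beta k by (intro mult_left_mono powr_mono2') auto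
    finally show "\<nu> s \<le> ?k * x powr (\<beta> - 1)" .
  qed (use assms in \<open>auto simp: set_integrable_def\<close>)
  also have "\<dots> = h * (?k * x powr (\<beta> - 1))"
    using assms by (simp add: set_lebesgue_integral_def)
  finally have "x powr \<alpha> * (LBINT s:{x<..<x+h}. \<nu> s) \<le> x powr \<alpha> * (h * (?k * x powr (\<beta> - 1)))"
    by (intro mult_left_mono) auto
  also have "\<dots> = h * ?k * x powr (\<alpha> + \<beta> - 1)"
    using assms by (simp add: powr_add powr_diff)
  also have "\<dots> \<le> h * ?k * h powr (\<alpha> + \<beta> - 1)"
    using assms k by (intro mult_left_mono powr_mono2') auto
  also have "\<dots> = C * (h powr \<alpha> * N h)"
    using assms by (simp add: powr_add powr_diff powr_minus field_simps)
  finally show ?thesis .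
qed

text \<open>
  The shift is moved from the kernel to the weight, which gives, up to a nonpositive boundary term,
  the integral of \<open>\<nu> s * s powr \<alpha>\<close> over \<open>{0<..<h}\<close> and that of
  \<open>\<nu> s * (s powr \<alpha> - (s - h) powr \<alpha>)\<close> over \<open>{h<..<x}\<close>. The first is at most \<open>h powr \<alpha> * N h\<close>. In the
  second the integrand is at most a constant times \<open>N h * h powr (1 - \<beta>) * s powr (\<alpha> + \<beta> - 2)\<close>; as
  \<open>\<alpha> + \<beta> - 2 < -1\<close>, the integral of the power is at most \<open>h powr (\<alpha> + \<beta> - 1) / (1 - \<alpha> - \<beta>)\<close>,
  however large \<open>x\<close> is.
\<close>

lemma kernel_variation_bound:
  assumes h: "0 < h" "h \<le> x" "x + h \<le> T" and \<alpha>: "0 < \<alpha>" "\<alpha> + \<beta> < 1"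
  shows "(LBINT s:{0<..<x}. (\<nu> s - \<nu> (s + h)) * s powr \<alpha>)
    \<le> (1 + C / (1 - \<alpha> - \<beta>)) * (h powr \<alpha> * N h)"
proof -
  let ?k = "C * N h * h powr (-\<beta>)"
  have k: "0 \<le> ?k" using C_pos primitive_nonneg[of h] h by auto
  have c: "continuous_on {0..T} (\<lambda>s. s powr \<alpha>)"
    using \<alpha> by (intro continuous_on_powr' continuous_intros) auto
  have ch: "continuous_on {h..T} (\<lambda>s. (s - h) powr \<alpha>)"
    using \<alpha> by (intro continuous_on_powr' continuous_intros) auto
  have i: "set_integrable lborel {u<..<v} (\<lambda>s. \<nu> s * s powr \<alpha>)" if "0 \<le> u" "v \<le> T" for u v
    using that c integrable_sub[of u v] by (intro set_integrable_mult_continuous[of _ _ 0 T]) auto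
  have ih: "set_integrable lborel {u<..<v} (\<lambda>s. \<nu> s * (s - h) powr \<alpha>)" if "h \<le> u" "v \<le> T" for u v
    using that h ch integrable_sub[of u v] by (intro set_integrable_mult_continuous[of _ _ h T]) auto
  have ish: "set_integrable lborel {0<..<x} (\<lambda>s. \<nu> (s + h) * s powr \<alpha>)"
    using ih[of h "x + h"] h
      set_integrable_shift_interval[of 0 x "\<lambda>s. \<nu> s * (s - h) powr \<alpha>" h] by simp
  have near: "(LBINT s:{0<..<h}. \<nu> s * s powr \<alpha>) \<le> h powr \<alpha> * N h"
  proof -
    have "(LBINT s:{0<..<h}. \<nu> s * s powr \<alpha>) \<le> (LBINT s:{0<..<h}. \<nu> s * h powr \<alpha>)"
    proof (intro set_integral_mono i)
      fix s assume s: "s \<in> {0<..<h}"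
      then have "0 < \<nu> s" using pos[of s] h by auto
      then show "\<nu> s * s powr \<alpha> \<le> \<nu> s * h powr \<alpha>"
        using s \<alpha> by (intro mult_left_mono powr_mono2) auto
    qed (use h integrable_sub in auto)
    then show ?thesis by (simp add: kernel_primitive_def mult.commute)
  qed
  \<comment> \<open>The boundary term over \<open>{x<..<x+h}\<close> enters with a minus sign, hence can be dropped.\<close>
  have "(LBINT s:{h<..<x+h}. \<nu> s * (s - h) powr \<alpha>) =
      (LBINT s:{h<..<x}. \<nu> s * (s - h) powr \<alpha>) + (LBINT s:{x<..<x+h}. \<nu> s * (s - h) powr \<alpha>)"
    using h by (intro set_integral_split_interval ih) auto
  moreover have "0 \<le> (LBINT s:{x<..<x+h}. \<nu> s * (s - h) powr \<alpha>)"
    unfolding set_lebesgue_integral_def using pos h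
    by (intro Bochner_Integration.integral_nonneg) (auto simp: indicator_def intro!: mult_nonneg_nonneg less_imp_le)
  ultimately have drop: "(LBINT s:{h<..<x}. \<nu> s * (s - h) powr \<alpha>) \<le> (LBINT s:{h<..<x+h}. \<nu> s * (s - h) powr \<alpha>)"
    by simp
  have ip: "set_integrable lborel {h<..<x} (\<lambda>s. s powr (\<alpha> + \<beta> - 2))"
    using h \<alpha> by (intro set_integral_powr) auto
  have "(LBINT s:{h<..<x}. \<nu> s * s powr \<alpha> - \<nu> s * (s - h) powr \<alpha>)
      \<le> (LBINT s:{h<..<x}. ?k * h * s powr (\<alpha> + \<beta> - 2))"
  proof (intro set_integral_mono)
    fix s assume s: "s \<in> {h<..<x}"
    have ns: "0 < \<nu> s" using pos[of s] s h by auto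
    have "\<nu> s * (s powr \<alpha> - (s - h) powr \<alpha>) \<le> \<nu> s * (h * s powr (\<alpha> - 1))"
      using s h \<alpha> beta ns by (intro mult_left_mono powr_increment_le) auto
    also have "\<dots> \<le> (?k * s powr (\<beta> - 1)) * (h * s powr (\<alpha> - 1))"
      using s h by (intro mult_right_mono kernel_le_primitive) auto
    also have "\<dots> = ?k * h * (s powr (\<beta> - 1) * s powr (\<alpha> - 1))" by (simp add: mult_ac)
    also have "s powr (\<beta> - 1) * s powr (\<alpha> - 1) = s powr (\<alpha> + \<beta> - 2)"
      using s h by (simp add: powr_add[symmetric]) (simp add: algebra_simps)
    finally show "\<nu> s * s powr \<alpha> - \<nu> s * (s - h) powr \<alpha> \<le> ?k * h * s powr (\<alpha> + \<beta> - 2)"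
      by (simp add: right_diff_distrib)
  next
    show "set_integrable lborel {h<..<x} (\<lambda>s. \<nu> s * s powr \<alpha> - \<nu> s * (s - h) powr \<alpha>)"
      using h by (intro set_integral_diff i ih) auto
    show "set_integrable lborel {h<..<x} (\<lambda>s. ?k * h * s powr (\<alpha> + \<beta> - 2))"
      using ip by simp
  qed
  also have "\<dots> = ?k * h * ((h powr (\<alpha> + \<beta> - 1) - x powr (\<alpha> + \<beta> - 1)) / (1 - \<alpha> - \<beta>))"
  proof -
    have "(LBINT s:{h<..<x}. s powr (\<alpha> + \<beta> - 2)) =
        (x powr (\<alpha> + \<beta> - 1) - h powr (\<alpha> + \<beta> - 1)) / (\<alpha> + \<beta> - 1)"
      using set_integral_powr(2)[of h x "\<alpha> + \<beta> - 2"] h \<alpha> by (simp add: algebra_simps)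
    also have "\<dots> = (h powr (\<alpha> + \<beta> - 1) - x powr (\<alpha> + \<beta> - 1)) / (1 - \<alpha> - \<beta>)"
      using minus_divide_divide[of "h powr (\<alpha> + \<beta> - 1) - x powr (\<alpha> + \<beta> - 1)" "1 - \<alpha> - \<beta>"]
      by (simp add: algebra_simps)
    finally show ?thesis by simp
  qed
  also have "\<dots> \<le> ?k * h * (h powr (\<alpha> + \<beta> - 1) / (1 - \<alpha> - \<beta>))"
    using k h \<alpha> by (intro mult_left_mono divide_right_mono) auto
  also have "\<dots> = C / (1 - \<alpha> - \<beta>) * (h powr \<alpha> * N h)"
    using h by (simp add: powr_add powr_diff powr_minus)
  finally have far: "(LBINT s:{h<..<x}. \<nu> s * s powr \<alpha>) - (LBINT s:{h<..<x}. \<nu> s * (s - h) powr \<alpha>)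
      \<le> C / (1 - \<alpha> - \<beta>) * (h powr \<alpha> * N h)"
    using i[of h x] ih[of h x] h by (simp add: set_integral_diff)
  have "(LBINT s:{0<..<x}. (\<nu> s - \<nu> (s + h)) * s powr \<alpha>) =
      (LBINT s:{0<..<x}. \<nu> s * s powr \<alpha>) - (LBINT s:{0<..<x}. \<nu> (s + h) * s powr \<alpha>)"
    using i[of 0 x] ish h by (simp add: left_diff_distrib set_integral_diff)
  also have "(LBINT s:{0<..<x}. \<nu> (s + h) * s powr \<alpha>) = (LBINT s:{h<..<x+h}. \<nu> s * (s - h) powr \<alpha>)"
    using set_integral_shift_interval[of 0 x "\<lambda>s. \<nu> s * (s - h) powr \<alpha>" h] by simp
  also have "(LBINT s:{0<..<x}. \<nu> s * s powr \<alpha>) =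
      (LBINT s:{0<..<h}. \<nu> s * s powr \<alpha>) + (LBINT s:{h<..<x}. \<nu> s * s powr \<alpha>)"
    using h by (intro set_integral_split_interval i) auto
  finally show ?thesis using near drop far by (simp add: algebra_simps)
qed

text \<open>
  The constant collects, in this order: \<open>1\<close> from the middle part of \<open>conv_op_difference\<close> together with
  \<open>1 + C / (1 - \<alpha> - \<beta>)\<close> from the variation of the kernel, \<open>C\<close> from the mass on \<open>{x<..<y}\<close>, and the
  cost of the Lipschitz error \<open>K\<close>.
\<close>

theorem conv_op_holder_estimate:
  assumes \<alpha>: "0 < \<alpha>" "\<alpha> + \<beta> < 1" and "0 \<le> K"
    and K: "\<And>u v. 0 < u \<Longrightarrow> u < v \<Longrightarrow> v < T \<Longrightarrow> \<bar>\<nu> u - \<nu> v\<bar> \<le> \<nu> u - \<nu> v + K * (v - u)"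
    and g: "holder_on \<alpha> {0..T} g" "g 0 = 0"
    and xy: "y / 2 \<le> x" "x < y" "y < T"
  shows "\<bar>conv_op \<nu> g x - conv_op \<nu> g y\<bar>
    \<le> (2 + C / (1 - \<alpha> - \<beta>) + C + K * T * C / \<nu> T)
        * holder_seminorm \<alpha> {0..T} g * \<bar>x - y\<bar> powr \<alpha> * N \<bar>x - y\<bar>"
proof -
  define h where "h = y - x"
  have h: "0 < h" "h \<le> x" "y = x + h" "x + h < T" using xy by (auto simp: h_def)
  define L where "L = holder_seminorm \<alpha> {0..T} g"
  define E where "E = h powr \<alpha> * N h"
  have gL: "\<bar>g u - g v\<bar> \<le> L * \<bar>u - v\<bar> powr \<alpha>" if "u \<in> {0..T}" "v \<in> {0..T}" for u v
    unfolding L_def using holder_seminorm_bound[OF g(1) that] .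
  have L: "0 \<le> L"
    unfolding L_def using T_pos by (intro holder_seminorm_nonneg[OF g(1), of 0 T]) auto
  have gc: "continuous_on {0..T} g" using holder_on_imp_continuous_on[OF g(1) \<alpha>(1)] .
  have gc': "continuous_on {0..y} g" using gc xy by (auto intro: continuous_on_subset)
  have c\<alpha>: "continuous_on {0..x} (\<lambda>s. s powr \<alpha>)"
    using \<alpha> by (intro continuous_on_powr' continuous_intros) auto
  have ix: "set_integrable lborel {0<..<x} \<nu>" "set_integrable lborel {0<..<x} (\<lambda>s. \<nu> (s + h))"
    using h integrable_sub by (auto simp: set_integrable_shift_interval)
  have i1: "set_integrable lborel {0<..<x} (\<lambda>s. (\<nu> (s + h) - \<nu> s) * (g (x - s) - g x))"
    using ix h gc'
    by (intro set_integrable_mult_continuous[of _ _ 0 x] continuous_intros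
        continuous_on_compose2[OF gc'] set_integral_diff) auto
  have i2: "set_integrable lborel {0<..<x} (\<lambda>s. (\<nu> s - \<nu> (s + h)) * s powr \<alpha>)"
    using ix c\<alpha> by (intro set_integrable_mult_continuous[of _ _ 0 x] set_integral_diff) auto
  have i3: "set_integrable lborel {0<..<h} (\<lambda>s. \<nu> s * (g (y - s) - g x))"
    using h integrable_sub[of 0 h]
    by (intro set_integrable_mult_continuous[of _ _ 0 h] continuous_intros
        continuous_on_compose2[OF gc']) auto
  have "\<bar>LBINT s:{0<..<x}. (\<nu> (s + h) - \<nu> s) * (g (x - s) - g x)\<bar>
      \<le> (LBINT s:{0<..<x}. L * ((\<nu> s - \<nu> (s + h)) * s powr \<alpha>) + L * K * h * T powr \<alpha>)"
  proof (rule set_integral_abs_bound[OF i1])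
    show "set_integrable lborel {0<..<x} (\<lambda>s. L * ((\<nu> s - \<nu> (s + h)) * s powr \<alpha>) + L * K * h * T powr \<alpha>)"
      using i2 h by (intro set_integral_add set_integrable_mult_right) (auto simp: set_integrable_def)
    fix s assume s: "s \<in> {0<..<x}"
    have "\<bar>(\<nu> (s + h) - \<nu> s) * (g (x - s) - g x)\<bar> = \<bar>\<nu> s - \<nu> (s + h)\<bar> * \<bar>g (x - s) - g x\<bar>"
      by (simp add: abs_mult abs_minus_commute)
    also have "\<dots> \<le> (\<nu> s - \<nu> (s + h) + K * h) * (L * s powr \<alpha>)"
      using K[of s "s + h"] gL[of "x - s" x] s h by (intro mult_mono) auto
    also have "\<dots> = L * ((\<nu> s - \<nu> (s + h)) * s powr \<alpha>) + L * K * h * s powr \<alpha>"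
      by (simp add: algebra_simps)
    also have "\<dots> \<le> L * ((\<nu> s - \<nu> (s + h)) * s powr \<alpha>) + L * K * h * T powr \<alpha>"
      using s h \<alpha> L \<open>0 \<le> K\<close> by (intro add_left_mono mult_left_mono powr_mono2) auto
    finally show "\<bar>(\<nu> (s + h) - \<nu> s) * (g (x - s) - g x)\<bar>
      \<le> L * ((\<nu> s - \<nu> (s + h)) * s powr \<alpha>) + L * K * h * T powr \<alpha>" .
  qed
  also have "\<dots> = L * (LBINT s:{0<..<x}. (\<nu> s - \<nu> (s + h)) * s powr \<alpha>) + x * (L * K * h * T powr \<alpha>)"
  proof -
    have "set_integrable lborel {0<..<x} (\<lambda>s. L * K * h * T powr \<alpha>)"
      using h by (simp add: set_integrable_def)
    moreover have "(LBINT s:{0<..<x}. L * K * h * T powr \<alpha>) = x * (L * K * h * T powr \<alpha>)"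
      using h by (simp add: set_lebesgue_integral_def)
    ultimately show ?thesis using i2 by (simp add: set_integral_add)
  qed
  also have "\<dots> \<le> L * ((1 + C / (1 - \<alpha> - \<beta>)) * E) + L * (K * T * C / \<nu> T * E)"
  proof (intro add_mono)
    show "L * (LBINT s:{0<..<x}. (\<nu> s - \<nu> (s + h)) * s powr \<alpha>) \<le> L * ((1 + C / (1 - \<alpha> - \<beta>)) * E)"
      unfolding E_def using L h \<alpha> by (intro mult_left_mono kernel_variation_bound) auto
    have \<nu>T: "0 < \<nu> T" using pos T_pos by simp
    have "h * T powr \<alpha> \<le> C * E / \<nu> T"
      using linear_le_primitive[of h \<alpha>] h \<alpha> \<nu>T by (simp add: E_def field_simps)
    then have "x * (L * K * (h * T powr \<alpha>)) \<le> T * (L * K * (C * E / \<nu> T))"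
      using h L \<open>0 \<le> K\<close> by (intro mult_mono mult_left_mono) auto
    then show "x * (L * K * h * T powr \<alpha>) \<le> L * (K * T * C / \<nu> T * E)" by (simp add: mult_ac)
  qed
  finally have b1: "\<bar>LBINT s:{0<..<x}. (\<nu> (s + h) - \<nu> s) * (g (x - s) - g x)\<bar>
      \<le> L * ((1 + C / (1 - \<alpha> - \<beta>)) * E) + L * (K * T * C / \<nu> T * E)" .
  have "\<bar>LBINT s:{0<..<h}. \<nu> s * (g (y - s) - g x)\<bar> \<le> (LBINT s:{0<..<h}. \<nu> s * (L * h powr \<alpha>))"
  proof (rule set_integral_abs_bound[OF i3])
    show "set_integrable lborel {0<..<h} (\<lambda>s. \<nu> s * (L * h powr \<alpha>))"
      using integrable_sub[of 0 h] h by auto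
    fix s assume s: "s \<in> {0<..<h}"
    have "\<bar>g (y - s) - g x\<bar> \<le> L * \<bar>y - s - x\<bar> powr \<alpha>" using s h by (intro gL) auto
    also have "\<dots> \<le> L * h powr \<alpha>" using s h \<alpha> L by (intro mult_left_mono powr_mono2) auto
    finally show "\<bar>\<nu> s * (g (y - s) - g x)\<bar> \<le> \<nu> s * (L * h powr \<alpha>)"
      using pos[of s] s h by (simp add: abs_mult mult_left_mono)
  qed
  then have b2: "\<bar>LBINT s:{0<..<h}. \<nu> s * (g (y - s) - g x)\<bar> \<le> L * E"
    by (simp add: E_def kernel_primitive_def mult_ac)
  have b3: "\<bar>g x * (LBINT s:{x<..<y}. \<nu> s)\<bar> \<le> L * (C * E)"
  proof -
    have I: "0 \<le> (LBINT s:{x<..<y}. \<nu> s)"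
      unfolding set_lebesgue_integral_def using pos h
      by (intro Bochner_Integration.integral_nonneg) (auto simp: indicator_def intro!: less_imp_le)
    have "\<bar>g x\<bar> \<le> L * x powr \<alpha>" using gL[of x 0] g(2) h by simp
    then have "\<bar>g x * (LBINT s:{x<..<y}. \<nu> s)\<bar> \<le> L * (x powr \<alpha> * (LBINT s:{x<..<y}. \<nu> s))"
      using I by (simp add: abs_mult mult_right_mono flip: mult.assoc)
    also have "\<dots> \<le> L * (C * E)"
      unfolding E_def \<open>y = x + h\<close>
      using L h \<alpha> by (intro mult_left_mono primitive_increment_bound) auto
    finally show ?thesis .
  qed
  have "conv_op \<nu> g y - conv_op \<nu> g x =
      (LBINT s:{0<..<x}. (\<nu> (s + h) - \<nu> s) * (g (x - s) - g x))
    + (LBINT s:{0<..<h}. \<nu> s * (g (y - s) - g x))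
    + g x * (LBINT s:{x<..<y}. \<nu> s)"
    by (rule conv_op_difference[OF integrable_sub gc' _ _ h_def]) (use xy h in auto)
  then have "\<bar>conv_op \<nu> g x - conv_op \<nu> g y\<bar>
      \<le> (L * ((1 + C / (1 - \<alpha> - \<beta>)) * E) + L * (K * T * C / \<nu> T * E)) + L * E + L * (C * E)"
    using b1 b2 b3 by linarith
  also have "\<dots> = (2 + C / (1 - \<alpha> - \<beta>) + C + K * T * C / \<nu> T) * L * h powr \<alpha> * N h"
    by (simp add: E_def algebra_simps)
  finally show ?thesis using h by (simp add: L_def)
qed

end

section \<open>The uniform constant\<close>

text \<open>
  The estimate is an assertion about \<open>T\<close>, \<open>\<alpha>\<close> and the values of \<open>\<nu>\<close> on \<open>{0<..<T}\<close>, so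
  whenever it holds with some constant, such a constant can be chosen as a function of these alone. Hence
  the explicit constant, which is built from arbitrary choices of \<open>bm\<close>, \<open>bp\<close> and \<open>K\<^sub>0\<close>, serves only to
  show that one exists for given data.
\<close>

theorem theorem3p1:
  shows "\<exists>c :: (real \<Rightarrow> real) \<Rightarrow> (real \<Rightarrow> real) \<Rightarrow> real \<Rightarrow> real \<Rightarrow> real \<Rightarrow> real.
    \<forall>T \<alpha> \<nu> \<tau>\<^sub>0 \<beta> b.
      0 < T \<longrightarrow> 0 < \<alpha> \<longrightarrow> \<alpha> < 1 \<longrightarrow>
      locally_AC_on {0<..T} \<nu> \<longrightarrow> set_integrable lborel {0<..<T} \<nu> \<longrightarrow>
      (\<forall>x\<in>{0<..T}. 0 < \<nu> x) \<longrightarrow>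
      0 < \<tau>\<^sub>0 \<longrightarrow> \<tau>\<^sub>0 \<le> T \<longrightarrow> 0 < \<beta> \<longrightarrow> \<beta> < 1 - \<alpha> \<longrightarrow>
      locally_AC_on {0<..<\<tau>\<^sub>0} b \<longrightarrow>
      (\<exists>bm bp. 0 < bm \<and> (\<forall>x\<in>{0<..<\<tau>\<^sub>0}. bm \<le> b x \<and> b x \<le> bp)) \<longrightarrow>
      antimono_on {0<..<\<tau>\<^sub>0} (\<lambda>x. x powr (1 - \<beta>) * b x * \<nu> x) \<longrightarrow>
      (\<exists>K\<^sub>0>0. \<forall>x\<in>{0<..<T}. \<forall>y\<in>{0<..<T}. x < y \<longrightarrow>
          \<bar>\<nu> x - \<nu> y\<bar> \<le> \<nu> x - \<nu> y + K\<^sub>0 * (y - x)) \<longrightarrow>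
      (\<forall>g. holder_on \<alpha> {0..T} g \<longrightarrow> g 0 = 0 \<longrightarrow>
        (\<forall>x\<in>{0<..<T}. \<forall>y\<in>{0<..<T}. y / 2 \<le> x \<longrightarrow> x < y \<longrightarrow>
          \<bar>conv_op \<nu> g x - conv_op \<nu> g y\<bar>
            \<le> c (restrict b {0<..<\<tau>\<^sub>0}) (restrict \<nu> {0<..T}) T \<alpha> \<beta>
                * holder_seminorm \<alpha> {0..T} g * \<bar>x - y\<bar> powr \<alpha>
                * kernel_primitive \<nu> \<bar>x - y\<bar>))"
proof -
  define valid where "valid \<nu> T \<alpha> c \<longleftrightarrow> (\<forall>g. holder_on \<alpha> {0..T} g \<longrightarrow> g 0 = 0 \<longrightarrow>
        (\<forall>x\<in>{0<..<T}. \<forall>y\<in>{0<..<T}. y / 2 \<le> x \<longrightarrow> x < y \<longrightarrow>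
          \<bar>conv_op \<nu> g x - conv_op \<nu> g y\<bar>
            \<le> c * holder_seminorm \<alpha> {0..T} g * \<bar>x - y\<bar> powr \<alpha>
                * kernel_primitive \<nu> \<bar>x - y\<bar>))" for \<nu> :: "real \<Rightarrow> real" and T \<alpha> c :: real
  have valid_restrict: "valid (restrict \<nu> {0<..T}) T \<alpha> c \<longleftrightarrow> valid \<nu> T \<alpha> c" for \<nu> T \<alpha> c
  proof -
    have "conv_op (restrict \<nu> {0<..T}) g t = conv_op \<nu> g t" if "t \<in> {0<..<T}" for g t
      unfolding conv_op_def using that by (intro set_lebesgue_integral_cong) auto
    moreover have "kernel_primitive (restrict \<nu> {0<..T}) t = kernel_primitive \<nu> t" if "t < T" for t
      unfolding kernel_primitive_def using that by (intro set_lebesgue_integral_cong) auto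
    ultimately show ?thesis unfolding valid_def by simp
  qed
  have ex: "\<exists>c. valid \<nu> T \<alpha> c"
    if "0 < T" "0 < \<alpha>"
      and ac: "locally_AC_on {0<..T} \<nu>" and int: "set_integrable lborel {0<..<T} \<nu>"
      and pos: "\<forall>x\<in>{0<..T}. 0 < \<nu> x"
      and \<tau>: "0 < \<tau>\<^sub>0" "\<tau>\<^sub>0 \<le> T" and \<beta>: "0 < \<beta>" "\<beta> < 1 - \<alpha>"
      and b: "\<exists>bm bp. 0 < bm \<and> (\<forall>x\<in>{0<..<\<tau>\<^sub>0}. bm \<le> b x \<and> b x \<le> bp)"
      and anti: "antimono_on {0<..<\<tau>\<^sub>0} (\<lambda>x. x powr (1 - \<beta>) * b x * \<nu> x)"
      and K: "\<exists>K\<^sub>0>0. \<forall>x\<in>{0<..<T}. \<forall>y\<in>{0<..<T}. x < y \<longrightarrow>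
          \<bar>\<nu> x - \<nu> y\<bar> \<le> \<nu> x - \<nu> y + K\<^sub>0 * (y - x)"
    for T \<alpha> \<nu> \<tau>\<^sub>0 \<beta> b
  proof -
    obtain bm bp where bm: "0 < bm" "\<And>x. x \<in> {0<..<\<tau>\<^sub>0} \<Longrightarrow> bm \<le> b x \<and> b x \<le> bp"
      using b by blast
    obtain K\<^sub>0 where K0: "0 < K\<^sub>0" "\<And>x y. x \<in> {0<..<T} \<Longrightarrow> y \<in> {0<..<T} \<Longrightarrow> x < y \<Longrightarrow>
          \<bar>\<nu> x - \<nu> y\<bar> \<le> \<nu> x - \<nu> y + K\<^sub>0 * (y - x)"
      using K by blast
    have "\<exists>C>0. \<forall>r s. 0 < r \<longrightarrow> r \<le> s \<longrightarrow> s \<le> T \<longrightarrow>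
        s powr (1 - \<beta>) * \<nu> s \<le> C * (r powr (1 - \<beta>) * \<nu> r)"
    proof (rule almost_decreasing_of_antimono_near_0[OF \<tau> _ _ bm(1), where b = b])
      fix a :: real assume "0 < a"
      then have "continuous_on {a..T} \<nu>"
        by (intro locally_AC_on_imp_continuous_on[OF ac]) auto
      then show "continuous_on {a..T} (\<lambda>s. s powr (1 - \<beta>) * \<nu> s)"
        using \<open>0 < a\<close>
        by (intro continuous_on_mult continuous_on_powr' continuous_on_id continuous_on_const) auto
    next
      show "antimono_on {0<..<\<tau>\<^sub>0} (\<lambda>s. b s * (s powr (1 - \<beta>) * \<nu> s))"
        using anti by (simp add: mult_ac)
    qed (use pos bm(2) in auto)
    then obtain C where C: "0 < C" "\<And>r s. 0 < r \<Longrightarrow> r \<le> s \<Longrightarrow> s \<le> T \<Longrightarrow>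
        s powr (1 - \<beta>) * \<nu> s \<le> C * (r powr (1 - \<beta>) * \<nu> r)" by blast
    interpret almost_decreasing_kernel \<nu> T \<beta> C
    proof unfold_locales
      fix r s :: real
      assume "0 < r" "r \<le> s" "s \<le> T"
      then show "s powr (1 - \<beta>) * \<nu> s \<le> C * (r powr (1 - \<beta>) * \<nu> r)" by (rule C(2))
    qed (use \<open>0 < T\<close> \<open>0 < \<alpha>\<close> int pos \<beta> C(1) in auto)
    have "valid \<nu> T \<alpha> (2 + C / (1 - \<alpha> - \<beta>) + C + K\<^sub>0 * T * C / \<nu> T)"
      unfolding valid_def
      by (intro allI impI ballI conv_op_holder_estimate) (use that K0 in auto)
    then show ?thesis ..
  qed
  show ?thesis
  proof (intro exI[of _ "\<lambda>_ \<nu> T \<alpha> _. SOME c. valid \<nu> T \<alpha> c"] allI impI ballI, goal_cases)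
    case (1 T \<alpha> \<nu> \<tau>\<^sub>0 \<beta> b g x y)
    have "valid \<nu> T \<alpha> (SOME c. valid \<nu> T \<alpha> c)"
      by (intro someI_ex[of "valid \<nu> T \<alpha>"] ex[of T \<alpha> \<nu> \<tau>\<^sub>0 \<beta> b] 1)
    then have "valid \<nu> T \<alpha> (SOME c. valid (restrict \<nu> {0<..T}) T \<alpha> c)"
      by (simp only: valid_restrict)
    from iffD1[OF valid_def this, rule_format, OF 1(15-)] show ?case .
  qed
qed

end
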